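(* Fix an integer $k\ge 1$. For every integer $n\ge 0$, the number of partitions of $n$ satisfying condition (P) equals the number of partitions of $n$ satisfying condition (S), where: (P) every part is either even or $\equiv 2k+5 \pmod{4k+8}$. (S) all of the following hold: - the difference between consecutive (adjacent) parts is never any of $1,3,\dots,2k+1$; - an odd part $2j+1$ is never immediately adjacent to $2j-2k-2$; - (initial condition, implied by a fictitious zero) the smallest part is not equal to any of $1,3,\dots,2k+3$. Moreover, the generating function of the partitions satisfying (P) is the periodic infinite product $\prod_m (1-q^m)^{-1}$ over all $m\ge1$ with $m$ even or $m\equiv 2k+5\pmod{4k+8}$; and a partition satisfies (S) if and only if its conjugate satisfies the following condition (C): (C) both of the following hold: - no part appears exactly $1$, $3$, $\dots$, or $2k+1$ times; - if a part appears exactly $2k+3$ times, then there are an odd number of parts strictly greater than it.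
   Context: Partitions $\lambda=(\lambda_1\ge\lambda_2\ge\dots\ge\lambda_r)$ have positive integer parts. Two parts are consecutive, or (immediately) adjacent, if they are $\lambda_i,\lambda_{i+1}$ for some $1\le i<r$. The initial condition is "implied by a fictitious zero" if it is what the difference/adjacency conditions impose when one part equal to $0$ is appended to the partition. Numbers of parts are counted with multiplicity. The conjugate of a partition is obtained by transposing its Ferrers diagram. *)

theory Defs
  imports "HOL-Analysis.Analysis" "HOL-Computational_Algebra.Formal_Power_Series"
    "HOL-Number_Theory.Cong"
begin

text \<open>A partition of \<open>n\<close> is the weakly decreasing list of its positive parts.\<close>

definition is_partition :: "nat list \<Rightarrow> bool" where
  "is_partition xs \<longleftrightarrow> sorted_wrt (\<ge>) xs \<and> 0 \<notin> set xs"

definition partitions_of :: "nat \<Rightarrow> nat list set" where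
  "partitions_of n = {xs. is_partition xs \<and> sum_list xs = n}"

definition ferrers :: "nat list \<Rightarrow> (nat \<times> nat) set" where
  "ferrers xs = {(i, j). i < length xs \<and> j < xs ! i}"

text \<open>The parts of the conjugate are the column lengths of the Ferrers diagram; the lemmas
  \<open>is_partition_conjugate\<close> and \<open>ferrers_conjugate\<close> below confirm that the result is the
  partition with the transposed diagram.\<close>

definition conjugate :: "nat list \<Rightarrow> nat list" where
  "conjugate xs =
     map (\<lambda>j. card {i. (i, j) \<in> ferrers xs}) [0..<(if xs = [] then 0 else hd xs)]"

definition consecutive_parts :: "nat list \<Rightarrow> nat \<Rightarrow> nat \<Rightarrow> bool" where
  "consecutive_parts xs a b \<longleftrightarrow> (\<exists>i. Suc i < length xs \<and> xs ! i = a \<and> xs ! Suc i = b)"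

definition cond_P :: "nat \<Rightarrow> nat list \<Rightarrow> bool" where
  "cond_P k xs \<longleftrightarrow> (\<forall>x\<in>set xs. even x \<or> [x = 2 * k + 5] (mod (4 * k + 8)))"

text \<open>The differences and the number \<open>2j - 2k - 2\<close> are taken in \<open>int\<close>, so nothing is
  truncated.  Parts are weakly decreasing, so \<open>2j + 1\<close> can only be the left one of two
  adjacent parts \<open>2j + 1\<close> and \<open>2j - 2k - 2\<close>.\<close>

definition cond_S :: "nat \<Rightarrow> nat list \<Rightarrow> bool" where
  "cond_S k xs \<longleftrightarrow>
     (\<forall>a b. consecutive_parts xs a b \<longrightarrow> int a - int b \<notin> {d. odd d \<and> 1 \<le> d \<and> d \<le> 2 * int k + 1}) \<and>
     (\<forall>a b j. consecutive_parts xs a b \<longrightarrow>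
        \<not> (int a = 2 * j + 1 \<and> int b = 2 * j - 2 * int k - 2)) \<and>
     (xs \<noteq> [] \<longrightarrow> Min (set xs) \<notin> {d. odd d \<and> d \<le> 2 * k + 3})"

definition cond_C :: "nat \<Rightarrow> nat list \<Rightarrow> bool" where
  "cond_C k xs \<longleftrightarrow>
     (\<forall>p\<in>set xs. count_list xs p \<notin> {d. odd d \<and> d \<le> 2 * k + 1}) \<and>
     (\<forall>p\<in>set xs. count_list xs p = 2 * k + 3 \<longrightarrow> odd (length (filter (\<lambda>x. x > p) xs)))"

lemma finite_partitions_of: "finite (partitions_of n)"
proof (rule finite_subset)
  show "partitions_of n \<subseteq> {xs. set xs \<subseteq> {..n} \<and> length xs \<le> n}"
  proof
    fix xs assume "xs \<in> partitions_of n"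
    then have xs: "0 \<notin> set xs" "sum_list xs = n"
      by (auto simp: partitions_of_def is_partition_def)
    have "length xs \<le> sum_list xs" if "0 \<notin> set xs"
      using that by (induction xs) auto
    with xs show "xs \<in> {xs. set xs \<subseteq> {..n} \<and> length xs \<le> n}"
      using member_le_sum_list by fastforce
  qed
qed (rule finite_lists_length_le, simp)

lemma ferrers_downward:
  assumes "is_partition xs" "(i, j) \<in> ferrers xs" "i' \<le> i" "j' \<le> j"
  shows "(i', j') \<in> ferrers xs"
proof -
  have "xs ! i \<le> xs ! i'"
  proof (cases "i' = i")
    case False
    with assms show ?thesis
      by (intro sorted_wrt_nth_less[of "(\<ge>)", simplified]) (auto simp: is_partition_def ferrers_def)
  qed simp
  with assms show ?thesis by (auto simp: ferrers_def)
qed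

lemma finite_column: "finite {i. (i, j) \<in> ferrers xs}"
  by (rule finite_subset[of _ "{..<length xs}"]) (auto simp: ferrers_def)

lemma column_eq:
  assumes "is_partition xs"
  shows "{i. (i, j) \<in> ferrers xs} = {..<card {i. (i, j) \<in> ferrers xs}}"
proof -
  let ?A = "{i. (i, j) \<in> ferrers xs}"
  have down: "i' \<in> ?A" if "i \<in> ?A" "i' \<le> i" for i i'
    using ferrers_downward[OF assms _ that(2) order_refl] that(1) by blast
  have "i < card ?A" if "i \<in> ?A" for i
  proof -
    have "{..i} \<subseteq> ?A" using down[OF that] by auto
    from card_mono[OF finite_column this] show ?thesis by simp
  qed
  then have sub: "?A \<subseteq> {..<card ?A}" by auto
  show ?thesis by (rule card_subset_eq[OF _ sub]) simp_all
qed

lemma ferrers_conjugate: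
  assumes "is_partition xs"
  shows "ferrers (conjugate xs) = (ferrers xs)\<inverse>"
proof -
  have "(j, i) \<in> ferrers (conjugate xs) \<longleftrightarrow> (i, j) \<in> ferrers xs" for i j
  proof -
    have col: "(i, j) \<in> ferrers xs \<longleftrightarrow> i < card {i. (i, j) \<in> ferrers xs}"
      using column_eq[OF assms, of j] by blast
    have wide: "xs \<noteq> [] \<and> j < hd xs" if "(i, j) \<in> ferrers xs"
    proof -
      have "xs \<noteq> []" using that by (auto simp: ferrers_def)
      moreover have "(0, j) \<in> ferrers xs" using ferrers_downward[OF assms that] by simp
      ultimately show ?thesis by (simp add: ferrers_def hd_conv_nth)
    qed
    have "(j, i) \<in> ferrers (conjugate xs) \<longleftrightarrow>
        (xs \<noteq> [] \<and> j < hd xs) \<and> i < card {i. (i, j) \<in> ferrers xs}"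
      by (subst ferrers_def) (auto simp: conjugate_def)
    with col wide show ?thesis by blast
  qed
  then show ?thesis by auto
qed

lemma is_partition_conjugate:
  assumes "is_partition xs"
  shows "is_partition (conjugate xs)"
proof -
  have "card {i. (i, j') \<in> ferrers xs} \<le> card {i. (i, j) \<in> ferrers xs}" if "j \<le> j'" for j j'
    using ferrers_downward[OF assms _ order_refl that] by (intro card_mono finite_column) auto
  then have "sorted_wrt (\<ge>) (conjugate xs)"
    by (auto simp: conjugate_def sorted_wrt_iff_nth_less)
  moreover have "card {i. (i, j) \<in> ferrers xs} \<noteq> 0" if "xs \<noteq> []" "j < hd xs" for j
  proof -
    have "0 \<in> {i. (i, j) \<in> ferrers xs}" using that by (simp add: ferrers_def hd_conv_nth)
    then show ?thesis using finite_column[of j xs] by (metis card_0_eq empty_iff)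
  qed
  then have "0 \<notin> set (conjugate xs)" by (fastforce simp: conjugate_def split: if_splits)
  ultimately show ?thesis by (simp add: is_partition_def)
qed

end

theory Submission
  imports Defs
begin

text \<open>Write \<open>M = 2 * k + 4\<close>.  Conjugation turns the difference of two neighbouring parts into a
  multiplicity, and the smaller of the two into the number of strictly larger parts; this is why
  (S) and (C) correspond, and why it remains to match (P) with (C).

  A partition with (C) is a partition in which every multiplicity is even, together with a set
  \<open>p\<^sub>1 > p\<^sub>2 > \<dots>\<close> of values that carry an odd multiplicity.  Only the parity of the number of
  parts above \<open>p\<^sub>i\<close> matters, which is the parity of \<open>i - 1\<close>, so the least possible odd
  multiplicities are \<open>M + 1, M - 1, M + 1, \<dots>\<close> in turn.  The even multiplicities contribute the
  factors \<open>1 / (1 - q^(2 i))\<close>, exactly as the even parts do in (P), and what is left is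
  \<open>\<Sum> q^((M + 1) p\<^sub>1 + (M - 1) p\<^sub>2 + (M + 1) p\<^sub>3 + \<dots>) = \<Prod>\<^sub>j 1 / (1 - q^(M + 1 + 2 M j))\<close>,
  where the sum is over all partitions into distinct parts.  The exponent is \<open>M\<close> times the size plus
  the alternating sum, so this is Sylvester's refinement of Euler's theorem on distinct and odd
  parts.

  For its proof, distinct partitions are sorted by their number of parts \<open>r\<close>: their Ferrers columns
  have all the lengths \<open>1, \<dots>, r\<close>, and the sum becomes \<open>\<Sum>\<^sub>r \<Prod>\<^sub>i z\<^sub>i / (1 - z\<^sub>i)\<close> over
  \<open>1 \<le> i \<le> r\<close> with \<open>z\<^sub>i = q^(M i + i mod 2)\<close> (\<open>distinct_fps_approx\<close>).
  Adding up the terms \<open>2 s - 1\<close> and \<open>2 s\<close> gives, with \<open>Q = q^(2 M)\<close> and \<open>z = q^(M + 1)\<close>,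
  the series \<open>\<Sum>\<^sub>s Q^(s (s - 1)) z^s / ((z; Q)\<^sub>s (Q; Q)\<^sub>s)\<close> of Cauchy's Durfee rectangle identity
  (\<open>sum_distinct_term\<close>).  Its value \<open>1 / (z; Q)\<^sub>\<infinity>\<close> follows by iterating the functional
  equation \<open>(1 - z) F(z) = F(z Q)\<close> (\<open>cauchy_sum_shift\<close>, \<open>cauchy_sum_approx\<close>).

  All infinite sums and products are truncated: each identity is an exact one between finite
  expressions, plus a boundary term divisible by a high power of the indeterminate.\<close>

section \<open>Conjugation: differences of parts and multiplicities\<close>

text \<open>The value \<open>0\<close> past the end of the list is the fictitious zero of the initial condition.\<close>

definition part_at :: "nat list \<Rightarrow> nat \<Rightarrow> nat" where
  "part_at xs i = (if i < length xs then xs ! i else 0)"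

text \<open>A partition can be recovered from its Ferrers diagram, and transposing twice is the identity.\<close>

lemma conjugate_conjugate:
  assumes "is_partition xs"
  shows "conjugate (conjugate xs) = xs"
proof -
  let ?c = "conjugate (conjugate xs)"
  have c: "is_partition ?c" by (intro is_partition_conjugate assms)
  have F: "ferrers ?c = ferrers xs"
    by (simp add: ferrers_conjugate is_partition_conjugate assms)
  have len: "{i. (i, 0) \<in> ferrers ys} = {..<length ys}" if "is_partition ys" for ys
    using that by (fastforce simp: ferrers_def is_partition_def in_set_conv_nth intro: gr0I)
  have row: "{j. (i, j) \<in> ferrers ys} = {..<ys ! i}" if "i < length ys" for ys i
    using that by (auto simp: ferrers_def)
  have l: "length ?c = length xs"
    using len[OF c] len[OF assms] unfolding F by (metis card_lessThan)
  show ?thesis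
  proof (rule nth_equalityI[OF l])
    fix i assume i: "i < length ?c"
    with l row[OF i] row[of i xs] show "?c ! i = xs ! i"
      unfolding F by (metis card_lessThan)
  qed
qed

lemma card_ferrers: "card (ferrers xs) = sum_list xs"
proof -
  have "ferrers xs = (SIGMA i:{..<length xs}. {..<xs ! i})" by (auto simp: ferrers_def)
  then show ?thesis by (simp add: sum_list_sum_nth atLeast0LessThan)
qed

lemma sum_list_conjugate:
  assumes "is_partition xs"
  shows "sum_list (conjugate xs) = sum_list xs"
  using card_inverse[of "ferrers xs"] card_ferrers[of xs] card_ferrers[of "conjugate xs"]
  by (simp add: ferrers_conjugate[OF assms])

lemma conjugate_eq_map:
  assumes "is_partition xs"
  shows "conjugate xs = map (\<lambda>j. card {i. j < part_at xs i}) [0..<part_at xs 0]"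
  unfolding conjugate_def
  by (auto simp: part_at_def ferrers_def hd_conv_nth intro!: arg_cong[of _ _ card])

lemma less_column_iff:
  assumes "is_partition xs"
  shows "p < card {i. j < part_at xs i} \<longleftrightarrow> j < part_at xs p"
proof -
  have e: "{i. j < part_at xs i} = {i. (i, j) \<in> ferrers xs}"
    by (auto simp: part_at_def ferrers_def split: if_splits)
  have "p \<in> {i. (i, j) \<in> ferrers xs} \<longleftrightarrow> p < card {i. (i, j) \<in> ferrers xs}"
    by (subst column_eq[OF assms]) simp
  then show ?thesis unfolding e by (auto simp: part_at_def ferrers_def)
qed

lemma part_at_mono:
  assumes "is_partition xs" "i \<le> j"
  shows "part_at xs j \<le> part_at xs i"
proof (rule ccontr)
  assume "\<not> ?thesis"
  then have "(j, part_at xs i) \<in> ferrers xs" by (auto simp: part_at_def ferrers_def split: if_splits)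
  from ferrers_downward[OF assms(1) this assms(2) order_refl] show False
    by (auto simp: ferrers_def part_at_def)
qed

lemma length_filter_map_upt: "length (filter P (map f [0..<n])) = card {j. j < n \<and> P (f j)}"
  by (simp add: length_filter_conv_card cong: conj_cong)

text \<open>The columns of length \<open>i + 1\<close> are those that meet row \<open>i\<close> but not row \<open>i + 1\<close>.\<close>

lemma count_list_conjugate:
  assumes "is_partition xs"
  shows "count_list (conjugate xs) (Suc i) = part_at xs i - part_at xs (Suc i)"
proof -
  have "count_list (conjugate xs) (Suc i) = card {j. j < part_at xs 0 \<and> Suc i = card {i. j < part_at xs i}}"
    unfolding count_list_eq_length_filter conjugate_eq_map[OF assms] length_filter_map_upt ..
  also have "{j. j < part_at xs 0 \<and> Suc i = card {i. j < part_at xs i}} = {part_at xs (Suc i)..<part_at xs i}"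
  proof -
    have "Suc i = card {i. j < part_at xs i} \<longleftrightarrow> part_at xs (Suc i) \<le> j \<and> j < part_at xs i" for j
      using less_column_iff[OF assms, of i j] less_column_iff[OF assms, of "Suc i" j] by linarith
    then have "{j. j < part_at xs 0 \<and> Suc i = card {i. j < part_at xs i}}
        = {j. j < part_at xs 0 \<and> part_at xs (Suc i) \<le> j \<and> j < part_at xs i}"
      by (simp only:)
    also have "\<dots> = {part_at xs (Suc i)..<part_at xs i}"
      using part_at_mono[OF assms le0, of i] by auto
    finally show ?thesis .
  qed
  finally show ?thesis by simp
qed

lemma parts_above_conjugate:
  assumes "is_partition xs"
  shows "length (filter (\<lambda>x. x > p) (conjugate xs)) = part_at xs p"
proof -
  have "length (filter (\<lambda>x. x > p) (conjugate xs)) = card {j. j < part_at xs 0 \<and> p < card {i. j < part_at xs i}}"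
    unfolding conjugate_eq_map[OF assms] length_filter_map_upt ..
  also have "{j. j < part_at xs 0 \<and> p < card {i. j < part_at xs i}} = {..<part_at xs p}"
    using less_column_iff[OF assms] part_at_mono[OF assms, of 0 p] by auto
  finally show ?thesis by simp
qed

text \<open>Common form of the two conditions: \<open>a \<ge> b\<close> are neighbouring parts, or dually \<open>a - b\<close> is a
  multiplicity and \<open>b\<close> the number of larger parts.\<close>

definition step_ok :: "nat \<Rightarrow> nat \<Rightarrow> nat \<Rightarrow> bool" where
  "step_ok k a b \<longleftrightarrow> \<not> (odd (a - b) \<and> a - b \<le> 2 * k + 1) \<and> (a - b = 2 * k + 3 \<longrightarrow> odd b)"

lemma cond_C_conjugate_iff:
  assumes "is_partition xs"
  shows "cond_C k (conjugate xs) \<longleftrightarrow> (\<forall>i. step_ok k (part_at xs i) (part_at xs (Suc i)))"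
proof -
  define R where "R p \<longleftrightarrow> \<not> (odd (count_list (conjugate xs) p) \<and> count_list (conjugate xs) p \<le> 2 * k + 1) \<and>
     (count_list (conjugate xs) p = 2 * k + 3 \<longrightarrow> odd (length (filter (\<lambda>x. x > p) (conjugate xs))))" for p
  \<comment> \<open>Values that do not occur have the even multiplicity 0, so the conditions may range over all
    positive values.\<close>
  have absent: "R p" if "p \<notin> set (conjugate xs)" for p
    using that count_notin[OF that] by (simp add: R_def)
  have "0 \<notin> set (conjugate xs)" using is_partition_conjugate[OF assms] by (simp add: is_partition_def)
  then have "cond_C k (conjugate xs) \<longleftrightarrow> (\<forall>i. R (Suc i))"
    unfolding cond_C_def using absent
    by (auto simp: R_def) (metis not0_implies_Suc)+
  also have "\<dots> \<longleftrightarrow> (\<forall>i. step_ok k (part_at xs i) (part_at xs (Suc i)))"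
    by (simp add: R_def step_ok_def count_list_conjugate parts_above_conjugate assms)
  finally show ?thesis .
qed

lemma adjacent_ok_iff:
  fixes a b :: nat
  assumes "b \<le> a"
  shows "int a - int b \<notin> {d. odd d \<and> 1 \<le> d \<and> d \<le> 2 * int k + 1} \<and>
      (\<forall>j. \<not> (int a = 2 * j + 1 \<and> int b = 2 * j - 2 * int k - 2)) \<longleftrightarrow> step_ok k a b"
proof -
  from le_Suc_ex[OF assms] obtain d where a: "a = b + d" by blast
  have "(\<exists>j. int a = 2 * j + 1 \<and> int b = 2 * j - 2 * int k - 2) \<longleftrightarrow> d = 2 * k + 3 \<and> even b"
  proof
    assume "\<exists>j. int a = 2 * j + 1 \<and> int b = 2 * j - 2 * int k - 2"
    then obtain j where j: "int a = 2 * j + 1" "int b = 2 * j - 2 * int k - 2" by blast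
    from j(2) have "int b = 2 * (j - int k - 1)" by simp
    then have "even (int b)" by (metis dvd_triv_left)
    moreover have "int d = int (2 * k + 3)" using j unfolding a by simp
    then have "d = 2 * k + 3" by (simp only: of_nat_eq_iff)
    ultimately show "d = 2 * k + 3 \<and> even b" by simp
  next
    assume d: "d = 2 * k + 3 \<and> even b"
    then have "even b" by simp
    then obtain h where "b = 2 * h" by (rule evenE)
    then have "int a = 2 * (int h + int k + 1) + 1 \<and> int b = 2 * (int h + int k + 1) - 2 * int k - 2"
      using d a by simp
    then show "\<exists>j. int a = 2 * j + 1 \<and> int b = 2 * j - 2 * int k - 2" by (rule exI)
  qed
  moreover have "int a - int b \<in> {d. odd d \<and> 1 \<le> d \<and> d \<le> 2 * int k + 1} \<longleftrightarrow> odd d \<and> d \<le> 2 * k + 1"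
  proof -
    have e: "int a - int b = int d" unfolding a by simp
    have "1 \<le> d" if "odd d" using odd_pos[OF that] by simp
    moreover have "int d \<le> 2 * int k + 1 \<longleftrightarrow> d \<le> 2 * k + 1" "1 \<le> int d \<longleftrightarrow> 1 \<le> d" by linarith+
    moreover have "odd (int d) \<longleftrightarrow> odd d" by simp
    ultimately show ?thesis unfolding e mem_Collect_eq by blast
  qed
  moreover have "a - b = d" using a by simp
  ultimately show ?thesis unfolding step_ok_def by blast
qed

text \<open>With the fictitious zero appended, the initial condition is the adjacency condition for the last
  part: \<open>0\<close> is even, so the difference \<open>2 * k + 3\<close> is excluded along with the smaller ones.\<close>

lemma cond_S_iff:
  assumes "is_partition xs"
  shows "cond_S k xs \<longleftrightarrow> (\<forall>i. step_ok k (part_at xs i) (part_at xs (Suc i)))"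
proof (cases "xs = []")
  case True
  then show ?thesis by (simp add: cond_S_def step_ok_def consecutive_parts_def part_at_def)
next
  case False
  let ?ok = "\<lambda>i. step_ok k (part_at xs i) (part_at xs (Suc i))"
  obtain l where l: "length xs = Suc l" using False by (cases xs) auto
  have at: "part_at xs i = xs ! i" if "i \<le> l" for i using that l by (simp add: part_at_def)
  have Min: "Min (set xs) = xs ! l"
  proof (rule Min_eqI)
    fix y assume "y \<in> set xs"
    then obtain i where "y = xs ! i" "i \<le> l" using l by (auto simp: in_set_conv_nth less_Suc_eq_le)
    then show "xs ! l \<le> y" using part_at_mono[OF assms, of i l] at by simp
  qed (use l in auto)
  have least: "odd x \<and> x \<le> 2 * k + 3 \<longleftrightarrow> odd x \<and> x \<le> 2 * k + 1 \<or> x = 2 * k + 3" for x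
  proof (cases "odd x")
    case True
    then obtain y where "x = 2 * y + 1" by (rule oddE)
    then show ?thesis by simp linarith
  qed auto
  have last: "Min (set xs) \<notin> {d. odd d \<and> d \<le> 2 * k + 3} \<longleftrightarrow> ?ok l"
  proof -
    have "part_at xs (Suc l) = 0" using l by (simp add: part_at_def)
    then show ?thesis using least[of "xs ! l"] by (simp add: step_ok_def at Min)
  qed
  have cons: "consecutive_parts xs a b \<longleftrightarrow> (\<exists>i<l. a = part_at xs i \<and> b = part_at xs (Suc i))" for a b
  proof -
    have "Suc i < length xs \<and> xs ! i = a \<and> xs ! Suc i = b \<longleftrightarrow> i < l \<and> a = part_at xs i \<and> b = part_at xs (Suc i)" for i
      using l at[of i] at[of "Suc i"] by auto
    then show ?thesis unfolding consecutive_parts_def by simp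
  qed
  have "cond_S k xs \<longleftrightarrow> (\<forall>a b. consecutive_parts xs a b \<longrightarrow>
      int a - int b \<notin> {d. odd d \<and> 1 \<le> d \<and> d \<le> 2 * int k + 1} \<and>
      (\<forall>j. \<not> (int a = 2 * j + 1 \<and> int b = 2 * j - 2 * int k - 2))) \<and> ?ok l"
    unfolding cond_S_def last using False by blast
  also have "\<dots> \<longleftrightarrow> (\<forall>i<l. ?ok i) \<and> ?ok l"
    unfolding cons adjacent_ok_iff[symmetric, OF part_at_mono[OF assms le_SucI[OF order_refl]]] by blast
  also have "\<dots> \<longleftrightarrow> (\<forall>i. ?ok i)"
  proof -
    have "?ok i" if "l < i" for i
      using that l by (simp add: part_at_def step_ok_def)
    then show ?thesis by (metis linorder_neqE_nat)
  qed
  finally show ?thesis .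
qed

section \<open>Generating functions of sets of partitions\<close>

text \<open>The form \<open>i = 1 + x i\<close> of \<open>(1 - x) i = 1\<close> is what the purely ring-theoretic steps below take as
  a premise.\<close>

lemma inverse_one_minus_X_power: assumes "m > 0" shows "inverse (1 - fps_X ^ m) = 1 + fps_X ^ m * inverse (1 - fps_X ^ m :: rat fps)"
proof -
  have "fps_nth (1 - fps_X ^ m :: rat fps) 0 \<noteq> 0" using assms by simp
  from inverse_mult_eq_1[OF this] show ?thesis by (simp add: algebra_simps)
qed

definition gen_fun :: "nat list set \<Rightarrow> rat fps" where
  "gen_fun A = Abs_fps (\<lambda>n. of_nat (card {xs \<in> A. sum_list xs = n}))"

lemma finite_fibre:
  assumes "\<And>xs. xs \<in> A \<Longrightarrow> is_partition xs"
  shows "finite {xs \<in> A. sum_list xs = n}"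
  by (rule finite_subset[OF _ finite_partitions_of[of n]]) (auto simp: partitions_of_def assms)

lemma gen_fun_Un:
  assumes "\<And>xs. xs \<in> A \<union> B \<Longrightarrow> is_partition xs" "A \<inter> B = {}"
  shows "gen_fun (A \<union> B) = gen_fun A + gen_fun B"
proof (rule fps_ext)
  fix n
  have "{xs \<in> A \<union> B. sum_list xs = n} = {xs \<in> A. sum_list xs = n} \<union> {xs \<in> B. sum_list xs = n}"
    by auto
  moreover have "card \<dots> = card {xs \<in> A. sum_list xs = n} + card {xs \<in> B. sum_list xs = n}"
    by (rule card_Un_disjoint) (use assms in \<open>auto intro!: finite_fibre\<close>)
  ultimately show "fps_nth (gen_fun (A \<union> B)) n = fps_nth (gen_fun A + gen_fun B) n"
    by (simp add: gen_fun_def)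
qed

lemma gen_fun_append: "gen_fun ((@) us ` A) = fps_X ^ sum_list us * gen_fun A"
proof (rule fps_ext)
  fix n
  have "{xs \<in> (@) us ` A. sum_list xs = n}
      = (if n < sum_list us then {} else (@) us ` {xs \<in> A. sum_list xs = n - sum_list us})"
    by auto
  moreover have "card ((@) us ` B) = card B" for B by (rule card_image) (simp add: inj_on_def)
  ultimately show "fps_nth (gen_fun ((@) us ` A)) n = fps_nth (fps_X ^ sum_list us * gen_fun A) n"
    by (simp add: gen_fun_def fps_X_power_mult_nth)
qed

definition parts_in :: "nat set \<Rightarrow> nat list set" where
  "parts_in A = {xs. is_partition xs \<and> set xs \<subseteq> A}"

text \<open>Add the largest admissible part last: a partition either avoids \<open>b\<close> or starts with it, and
  removing that first part leaves a partition of the same kind, so \<open>f = g + X^b f\<close>.\<close>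

lemma gen_fun_parts_in:
  assumes "finite A" "0 \<notin> A"
  shows "gen_fun (parts_in A) = (\<Prod>m\<in>A. inverse (1 - fps_X ^ m))"
  using assms
proof (induction A rule: finite_linorder_max_induct)
  case empty
  have "{xs \<in> parts_in {}. sum_list xs = n} = (if n = 0 then {[]} else {})" for n
    by (auto simp: parts_in_def is_partition_def)
  then show ?case by (simp add: gen_fun_def fps_eq_iff)
next
  case (insert b A)
  have le: "y \<le> b" if "y \<in> set ys" "set ys \<subseteq> insert b A" for y ys
  proof -
    have "y \<in> insert b A" using that by blast
    then show ?thesis using insert.hyps(2) by (auto intro: less_imp_le)
  qed
  have eq: "parts_in (insert b A) = parts_in A \<union> (@) [b] ` parts_in (insert b A)"
  proof (intro subset_antisym subsetI)
    fix xs assume xs: "xs \<in> parts_in (insert b A)"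
    show "xs \<in> parts_in A \<union> (@) [b] ` parts_in (insert b A)"
    proof (cases "b \<in> set xs")
      case True
      then obtain y ys where e: "xs = y # ys" by (cases xs) auto
      with xs insert.hyps(2) True have "y = b"
        by (auto simp: parts_in_def is_partition_def) (meson leD)+
      with xs e show ?thesis by (auto simp: parts_in_def is_partition_def)
    qed (use xs in \<open>auto simp: parts_in_def\<close>)
  next
    fix xs assume "xs \<in> parts_in A \<union> (@) [b] ` parts_in (insert b A)"
    then show "xs \<in> parts_in (insert b A)"
      using insert.prems le by (auto simp: parts_in_def is_partition_def)
  qed
  have disj: "parts_in A \<inter> (@) [b] ` parts_in (insert b A) = {}"
    using insert.hyps(2) by (auto simp: parts_in_def)
  have "gen_fun (parts_in (insert b A))
      = gen_fun (parts_in A) + fps_X ^ b * gen_fun (parts_in (insert b A))"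
    by (subst eq, subst gen_fun_Un) (use disj eq in \<open>auto simp: gen_fun_append[of "[b]", simplified] parts_in_def\<close>)
  moreover have "b > 0" using insert.prems by auto
  note inverse_one_minus_X_power[OF this]
  moreover have "f = g * i" if "f = g + x * f" "i = 1 + x * i" for f g i x :: "rat fps"
    using that by algebra
  ultimately have "gen_fun (parts_in (insert b A)) = gen_fun (parts_in A) * inverse (1 - fps_X ^ b)"
    by blast
  moreover have "b \<notin> A" using insert.hyps(2) by blast
  ultimately show ?case using insert by (simp add: mult.commute)
qed

section \<open>The generating function of condition (C)\<close>

text \<open>\<open>s\<close> is the parity of the number of parts that lie above: an odd multiplicity must be at least
  \<open>2 * k + 3\<close>, and the value \<open>2 * k + 3\<close> itself requires an odd number of larger parts.\<close>

definition least_odd_mult :: "nat \<Rightarrow> bool \<Rightarrow> nat" where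
  "least_odd_mult k s = (if s then 2 * k + 3 else 2 * k + 5)"

lemma odd_least_odd_mult [simp]: "odd (least_odd_mult k s)"
  by (simp add: least_odd_mult_def)

lemma least_odd_mult_ge: "3 \<le> least_odd_mult k s"
  by (simp add: least_odd_mult_def)

text \<open>The generating function of the strictly decreasing sequences of positive integers at most \<open>n\<close>,
  in which the entries are weighted in turn by the two least odd multiplicities, beginning
  with the one for \<open>s\<close>.  The recursion decides whether \<open>n\<close> is the first entry.\<close>

fun distinct_fps :: "nat \<Rightarrow> bool \<Rightarrow> nat \<Rightarrow> rat fps" where
  "distinct_fps k s 0 = 1"
| "distinct_fps k s (Suc n) = distinct_fps k s n + fps_X ^ (least_odd_mult k s * Suc n) * distinct_fps k (\<not> s) n"

text \<open>Condition (C) relative to an outer context: the partition is thought of as lying below further,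
  larger parts whose number has parity \<open>s\<close>.  This makes the condition hereditary when the largest
  part is removed with all its copies.\<close>

definition C_partitions:: "nat \<Rightarrow> bool \<Rightarrow> nat \<Rightarrow> nat list set" where
  "C_partitions k s n = {xs. is_partition xs \<and> set xs \<subseteq> {..n} \<and>
     (\<forall>p\<in>set xs. count_list xs p \<notin> {d. odd d \<and> d \<le> 2 * k + 1} \<and>
       (count_list xs p = 2 * k + 3 \<longrightarrow> odd (length (filter (\<lambda>x. x > p) xs)) \<noteq> s))}"

lemma is_partition_replicate_append:
  assumes "set ys \<subseteq> {..n}"
  shows "is_partition (replicate m (Suc n) @ ys) \<longleftrightarrow> is_partition ys"
  using assms by (induction m) (auto simp: is_partition_def le_SucI)

lemma partition_split_largest:
  assumes "is_partition xs" "set xs \<subseteq> {..Suc n}"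
  obtains m ys where "xs = replicate m (Suc n) @ ys" "set ys \<subseteq> {..n}" "is_partition ys"
proof -
  have "\<exists>m ys. xs = replicate m (Suc n) @ ys \<and> set ys \<subseteq> {..n}"
    using assms
  proof (induction xs)
    case Nil
    show ?case by (intro exI[of _ 0] exI[of _ "[]"]) simp
  next
    case (Cons x xs)
    show ?case
    proof (cases "x = Suc n")
      case True
      from Cons obtain m ys where "xs = replicate m (Suc n) @ ys" "set ys \<subseteq> {..n}"
        by (auto simp: is_partition_def)
      with True show ?thesis by (intro exI[of _ "Suc m"] exI[of _ ys]) simp
    next
      case False
      with Cons.prems have "set (x # xs) \<subseteq> {..n}" by (fastforce simp: is_partition_def le_Suc_eq)
      then show ?thesis by (intro exI[of _ 0]) simp
    qed
  qed
  then obtain m ys where e: "xs = replicate m (Suc n) @ ys" "set ys \<subseteq> {..n}" by blast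
  moreover have "is_partition ys" using is_partition_replicate_append[OF e(2)] assms e by simp
  ultimately show ?thesis by (rule that)
qed

text \<open>Prepending \<open>m\<close> copies of a new largest part changes the parity seen by all other parts
  by \<open>m\<close>, and nothing else.\<close>

lemma C_partitions_replicate_append:
  assumes ys: "set ys \<subseteq> {..n}"
  shows "replicate m (Suc n) @ ys \<in> C_partitions k s (Suc n) \<longleftrightarrow>
    (even m \<or> least_odd_mult k s \<le> m) \<and> ys \<in> C_partitions k (s \<noteq> odd m) n"
proof -
  let ?xs = "replicate m (Suc n) @ ys"
  have notin: "Suc n \<notin> set ys" using ys by auto
  have top: "count_list ?xs (Suc n) = m" "filter (\<lambda>x. x > Suc n) ?xs = []"
    using notin ys by (auto simp: count_list_eq_length_filter filter_empty_conv)
  have below: "count_list ?xs p = count_list ys p"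
    "length (filter (\<lambda>x. x > p) ?xs) = m + length (filter (\<lambda>x. x > p) ys)" if "p \<in> set ys" for p
    using that ys by (auto simp: count_list_eq_length_filter filter_replicate)
  define Q where "Q t c a \<longleftrightarrow> c \<notin> {d. odd d \<and> d \<le> 2 * k + 1} \<and> (c = 2 * k + 3 \<longrightarrow> odd a \<noteq> t)"
    for t c and a :: nat
  have shift: "Q s c (m + a) \<longleftrightarrow> Q (s \<noteq> odd m) c a" for c a
    unfolding Q_def by auto
  have m: "(Q s m 0 \<or> m = 0) \<longleftrightarrow> even m \<or> least_odd_mult k s \<le> m"
  proof -
    have "\<not> (odd m \<and> m \<le> 2 * k + 1) \<longleftrightarrow> even m \<or> 2 * k + 3 \<le> m"
      "even m \<or> 2 * k + 3 \<le> m \<and> m \<noteq> 2 * k + 3 \<longleftrightarrow> even m \<or> 2 * k + 5 \<le> m"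
      by presburger+
    then show ?thesis by (cases s) (auto simp: Q_def least_odd_mult_def)
  qed
  have "(\<forall>p\<in>set ?xs. Q s (count_list ?xs p) (length (filter (\<lambda>x. x > p) ?xs))) \<longleftrightarrow>
    (Q s m 0 \<or> m = 0) \<and> (\<forall>p\<in>set ys. Q s (count_list ys p) (m + length (filter (\<lambda>x. x > p) ys)))"
    unfolding set_append ball_Un using below top by (simp cong: ball_cong)
  moreover have "set ?xs \<subseteq> {..Suc n}" using ys by auto
  moreover have C: "zs \<in> C_partitions k t l \<longleftrightarrow> is_partition zs \<and> set zs \<subseteq> {..l} \<and>
      (\<forall>p\<in>set zs. Q t (count_list zs p) (length (filter (\<lambda>x. x > p) zs)))" for zs t l
    by (simp add: C_partitions_def Q_def)
  ultimately show ?thesis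
    unfolding C m shift is_partition_replicate_append[OF ys] using ys by blast
qed

text \<open>Two copies of the largest part can be removed without affecting any parity; this is possible
  unless the multiplicity is already the least one of its parity.\<close>

lemma C_partitions_rec:
  "C_partitions k s (Suc n) = C_partitions k s n
     \<union> ((@) (replicate (least_odd_mult k s) (Suc n)) ` C_partitions k (\<not> s) n
     \<union> (@) (replicate 2 (Suc n)) ` C_partitions k s (Suc n))"
  (is "_ = ?A \<union> (?B \<union> ?C)")
proof (intro subset_antisym subsetI)
  fix xs assume xs: "xs \<in> C_partitions k s (Suc n)"
  then obtain m ys where e: "xs = replicate m (Suc n) @ ys" and ys: "set ys \<subseteq> {..n}"
    by (auto simp: C_partitions_def elim: partition_split_largest)
  have ok: "even m \<or> least_odd_mult k s \<le> m" and ysC: "ys \<in> C_partitions k (s \<noteq> odd m) n"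
    using xs unfolding e C_partitions_replicate_append[OF ys] by auto
  consider "m = 0" | "m = least_odd_mult k s"
    | m' where "m = 2 + m'" "even m' \<or> least_odd_mult k s \<le> m'"
  proof -
    assume *: "m = 0 \<Longrightarrow> thesis" "m = least_odd_mult k s \<Longrightarrow> thesis"
      "\<And>m'. m = 2 + m' \<Longrightarrow> even m' \<or> least_odd_mult k s \<le> m' \<Longrightarrow> thesis"
    have "even (m - 2) \<or> least_odd_mult k s \<le> m - 2" "2 \<le> m" if "m \<noteq> 0" "m \<noteq> least_odd_mult k s"
      using ok odd_least_odd_mult[of k s] that by presburger+
    with *(1,2) *(3)[of "m - 2"] show thesis by fastforce
  qed
  then show "xs \<in> ?A \<union> (?B \<union> ?C)"
  proof cases
    case 3
    have "replicate m' (Suc n) @ ys \<in> C_partitions k s (Suc n)"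
      unfolding C_partitions_replicate_append[OF ys] using 3 ysC by simp
    then have "xs \<in> ?C" unfolding e 3(1) replicate_add append_assoc by (rule imageI)
    then show ?thesis by blast
  qed (use ysC e in auto)
next
  have below: "set ys \<subseteq> {..n}" if "ys \<in> C_partitions k t n" for t ys
    using that by (simp add: C_partitions_def)
  fix xs assume "xs \<in> ?A \<union> (?B \<union> ?C)"
  then show "xs \<in> C_partitions k s (Suc n)"
  proof (elim UnE imageE)
    assume xs: "xs \<in> C_partitions k s n"
    then show ?thesis
      using C_partitions_replicate_append[OF below[OF xs], where m = 0 and k = k and s = s] by simp
  next
    fix ys assume e: "xs = replicate (least_odd_mult k s) (Suc n) @ ys" and ys: "ys \<in> C_partitions k (\<not> s) n"
    from ys show ?thesis
      unfolding e C_partitions_replicate_append[OF below[OF ys]] by simp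
  next
    fix zs assume e: "xs = replicate 2 (Suc n) @ zs" and zs: "zs \<in> C_partitions k s (Suc n)"
    then obtain m ys where z: "zs = replicate m (Suc n) @ ys" and ys: "set ys \<subseteq> {..n}"
      by (auto simp: C_partitions_def elim: partition_split_largest)
    have "xs = replicate (2 + m) (Suc n) @ ys" unfolding e z replicate_add append_assoc ..
    then show ?thesis
      using zs unfolding z by (auto simp only: C_partitions_replicate_append[OF ys]) auto
  qed
qed

lemma C_partitions_rec_disjoint:
  shows "C_partitions k s n \<inter> ((@) (replicate (least_odd_mult k s) (Suc n)) ` C_partitions k (\<not> s) n
     \<union> (@) (replicate 2 (Suc n)) ` C_partitions k s (Suc n)) = {}" (is "?A \<inter> (?B \<union> ?C) = _")
   and "(@) (replicate (least_odd_mult k s) (Suc n)) ` C_partitions k (\<not> s) n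
     \<inter> (@) (replicate 2 (Suc n)) ` C_partitions k s (Suc n) = {}"
proof -
  have below: "set ys \<subseteq> {..n}" if "ys \<in> C_partitions k t n" for t ys
    using that by (simp add: C_partitions_def)
  have "Suc n \<in> set (replicate m (Suc n) @ zs)" if "0 < m" for m zs
    using that by simp
  moreover have "0 < least_odd_mult k s" "0 < (2 :: nat)" using least_odd_mult_ge[of k s] by simp_all
  ultimately have "Suc n \<in> set xs" if "xs \<in> ?B \<union> ?C" for xs
    using that by blast
  moreover have "Suc n \<notin> set xs" if "xs \<in> ?A" for xs
    using below[OF that] by auto
  ultimately show "?A \<inter> (?B \<union> ?C) = {}" by blast
  show "?B \<inter> ?C = {}"
  proof (rule equals0I)
    fix xs assume "xs \<in> ?B \<inter> ?C"
    then obtain ys zs where e: "xs = replicate (least_odd_mult k s) (Suc n) @ ys" "xs = replicate 2 (Suc n) @ zs"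
      and ys: "ys \<in> C_partitions k (\<not> s) n" and zs: "zs \<in> C_partitions k s (Suc n)" by blast
    have b: "least_odd_mult k s = 2 + (least_odd_mult k s - 2)" using least_odd_mult_ge[of k s] by simp
    then have "replicate (least_odd_mult k s) (Suc n) = replicate 2 (Suc n) @ replicate (least_odd_mult k s - 2) (Suc n)"
      by (metis replicate_add)
    then have "replicate 2 (Suc n) @ zs = replicate 2 (Suc n) @ replicate (least_odd_mult k s - 2) (Suc n) @ ys"
      using e by (metis append_assoc)
    then have "zs = replicate (least_odd_mult k s - 2) (Suc n) @ ys" by (simp only: append_same_eq same_append_eq)
    with zs have "even (least_odd_mult k s - 2) \<or> least_odd_mult k s \<le> least_odd_mult k s - 2"
      using C_partitions_replicate_append[OF below[OF ys]] by blast
    then show False using odd_least_odd_mult[of k s] b by presburger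
  qed
qed

lemma gen_fun_C_partitions_rec:
  "gen_fun (C_partitions k s (Suc n)) * (1 - fps_X ^ (2 * Suc n)) = gen_fun (C_partitions k s n)
     + fps_X ^ (least_odd_mult k s * Suc n) * gen_fun (C_partitions k (\<not> s) n)"
proof -
  let ?B = "(@) (replicate (least_odd_mult k s) (Suc n)) ` C_partitions k (\<not> s) n"
  let ?C = "(@) (replicate 2 (Suc n)) ` C_partitions k s (Suc n)"
  have part: "is_partition xs" if "xs \<in> C_partitions k s n \<union> (?B \<union> ?C)" for xs
    using that unfolding C_partitions_rec[symmetric] by (simp add: C_partitions_def)
  have "gen_fun (?B \<union> ?C) = gen_fun ?B + gen_fun ?C"
    by (rule gen_fun_Un[OF part C_partitions_rec_disjoint(2)]) blast
  moreover have "gen_fun (C_partitions k s n \<union> (?B \<union> ?C)) = gen_fun (C_partitions k s n) + gen_fun (?B \<union> ?C)"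
    by (rule gen_fun_Un[OF part C_partitions_rec_disjoint(1)])
  ultimately have "gen_fun (C_partitions k s (Suc n)) = gen_fun (C_partitions k s n) + (gen_fun ?B + gen_fun ?C)"
    unfolding C_partitions_rec[symmetric] by simp
  also have "gen_fun ?B = fps_X ^ (least_odd_mult k s * Suc n) * gen_fun (C_partitions k (\<not> s) n)"
    by (simp only: gen_fun_append sum_list_replicate of_nat_id)
  also have "gen_fun ?C = fps_X ^ (2 * Suc n) * gen_fun (C_partitions k s (Suc n))"
    by (simp only: gen_fun_append sum_list_replicate of_nat_id)
  finally show ?thesis by (simp add: algebra_simps)
qed

text \<open>The even multiplicities split off as the product; the factor that remains
  only sees which parts have odd multiplicity.\<close>

lemma gen_fun_C_partitions:
  "gen_fun (C_partitions k s n) = distinct_fps k s n * (\<Prod>i\<in>{1..n}. inverse (1 - fps_X ^ (2 * i)))"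
proof (induction n arbitrary: s)
  case 0
  have "xs = []" if "set xs \<subseteq> {..0}" "0 \<notin> set xs" for xs :: "nat list"
    using that by (cases xs) auto
  then have "C_partitions k s 0 = parts_in {}"
    unfolding C_partitions_def parts_in_def is_partition_def by fastforce
  then show ?case by (simp add: gen_fun_parts_in)
next
  case (Suc n)
  let ?P = "\<Prod>i\<in>{1..n}. inverse (1 - fps_X ^ (2 * i)) :: rat fps"
  let ?i = "inverse (1 - fps_X ^ (2 * Suc n)) :: rat fps"
  have "?i = 1 + fps_X ^ (2 * Suc n) * ?i" by (rule inverse_one_minus_X_power) simp
  moreover note gen_fun_C_partitions_rec[of k s n, unfolded Suc]
  moreover have "g = (a + b * c) * (P * i)"
    if "i = 1 + x * i" "g * (1 - x) = a * P + b * (c * P)" for g a b c P i x :: "rat fps"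
    using that by algebra
  ultimately have "gen_fun (C_partitions k s (Suc n)) = distinct_fps k s (Suc n) * (?P * ?i)"
    unfolding distinct_fps.simps by blast
  then show ?case by simp
qed

section \<open>Distinct partitions sorted by their number of parts\<close>

text \<open>The weight of the sequence \<open>1, \<dots>, 1\<close> of length \<open>r\<close>, that is, the sum of the first \<open>r\<close> terms of
  \<open>2 * k + 5, 2 * k + 3, 2 * k + 5, \<dots>\<close>.\<close>

definition distinct_weight :: "nat \<Rightarrow> nat \<Rightarrow> nat" where
  "distinct_weight k r = (2 * k + 4) * r + r mod 2"

lemma distinct_weight_Suc: "distinct_weight k (Suc r) = distinct_weight k r + least_odd_mult k (odd r)"
  by (cases "even r") (auto simp: distinct_weight_def least_odd_mult_def elim!: evenE oddE)

lemma distinct_weight_ge: "r \<le> distinct_weight k r"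
  unfolding distinct_weight_def by (rule trans_le_add1) simp

text \<open>The generating function of the strictly decreasing sequences of exactly \<open>r\<close> positive integers:
  in the Ferrers diagram each of the column lengths \<open>1, \<dots>, r\<close> occurs at least once.\<close>

fun distinct_term :: "nat \<Rightarrow> nat \<Rightarrow> rat fps" where
  "distinct_term k 0 = 1"
| "distinct_term k (Suc r) = distinct_term k r * fps_X ^ distinct_weight k (Suc r)
     * inverse (1 - fps_X ^ distinct_weight k (Suc r))"

text \<open>Subtracting \<open>1\<close> from \<open>r + 1\<close> distinct positive entries gives \<open>r + 1\<close> such entries, or \<open>r\<close> of them
  and a zero.\<close>

lemma distinct_term_split: "fps_X ^ distinct_weight k (Suc r) * (distinct_term k r + distinct_term k (Suc r)) = distinct_term k (Suc r)"
proof -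
  have "0 < distinct_weight k (Suc r)" using distinct_weight_ge[of "Suc r" k] by linarith
  note inverse_one_minus_X_power[OF this]
  moreover have "x * (c + c * x * i) = c * x * i" if "i = 1 + x * i" for x c i :: "rat fps"
    using that by algebra
  ultimately show ?thesis unfolding distinct_term.simps by blast
qed

text \<open>Cut a distinct partition at the threshold \<open>n\<close>: if \<open>r\<close> entries exceed \<open>n\<close>, they contribute
  \<open>z\<^sub>r^n\<close> times the term for \<open>r\<close>, and the entries up to \<open>n\<close> start at the parity of \<open>r\<close>.
  Summed over all \<open>r\<close> the result does not depend on \<open>n\<close>; cutting the sum off at \<open>R\<close> leaves one
  boundary term.\<close>

lemma distinct_fps_step:
  "(\<Sum>r\<le>R. fps_X ^ (distinct_weight k r * Suc n) * distinct_term k r * distinct_fps k (odd r) (Suc n))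
   = (\<Sum>r\<le>R. fps_X ^ (distinct_weight k r * n) * distinct_term k r * distinct_fps k (odd r) n)
     + fps_X ^ (distinct_weight k (Suc R) * Suc n) * distinct_term k R * distinct_fps k (even R) n"
proof (induction R)
  case 0
  show ?case by (simp add: distinct_weight_def least_odd_mult_def)
next
  case (Suc R)
  define x where "x = (fps_X ^ (distinct_weight k (Suc R) * n) :: rat fps)"
  define z where "z = (fps_X ^ distinct_weight k (Suc R) :: rat fps)"
  define b where "b = (fps_X ^ (least_odd_mult k (even R) * Suc n) :: rat fps)"
  define c where "c = distinct_term k R"
  define d where "d = distinct_term k (Suc R)"
  have xz: "fps_X ^ (distinct_weight k (Suc R) * Suc n) = x * z"
    by (simp add: x_def z_def power_add[symmetric])
  have xzb: "fps_X ^ (distinct_weight k (Suc (Suc R)) * Suc n) = x * z * b"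
    unfolding xz[symmetric] b_def power_add[symmetric] distinct_weight_Suc[of k "Suc R"]
    by (simp only: add_mult_distrib) simp
  have d: "z * (c + d) = d" unfolding z_def c_def d_def by (rule distinct_term_split)
  have step: "t + x * z * c * u + x * z * d * (u + b * v) = t + x * d * u + x * z * b * d * v"
    if d: "z * (c + d) = d" for t x z c d u v b :: "rat fps"
  proof -
    have "t + x * z * c * u + x * z * d * (u + b * v) = t + x * (z * (c + d)) * u + x * z * b * d * v"
      by (simp add: algebra_simps)
    then show ?thesis by (simp only: d)
  qed
  show ?case
    unfolding sum.atMost_Suc Suc xz xzb c_def[symmetric] d_def[symmetric] x_def[symmetric]
      distinct_fps.simps(2)[of k "odd (Suc R)" n]
    using step[OF d] by (simp add: b_def del: power_Suc mult_Suc_right)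
qed

text \<open>Compare the thresholds \<open>0\<close>, where all entries lie above, and \<open>n\<close>, where up to order \<open>n\<close> none does.\<close>

lemma distinct_fps_approx:
  assumes "N \<le> n" "N \<le> R"
  shows "fps_X ^ N dvd distinct_fps k False n - (\<Sum>r\<le>R. distinct_term k r)"
proof -
  let ?T = "\<lambda>n. \<Sum>r\<le>R. fps_X ^ (distinct_weight k r * n) * distinct_term k r * distinct_fps k (odd r) n"
  have "fps_X ^ N dvd ?T n - ?T 0" for n
  proof (induction n)
    case (Suc n)
    have "N \<le> Suc R * Suc n" using assms by (simp add: trans_le_add1)
    also have "\<dots> \<le> distinct_weight k (Suc R) * Suc n" by (rule mult_le_mono1[OF distinct_weight_ge])
    finally have "fps_X ^ N dvd fps_X ^ (distinct_weight k (Suc R) * Suc n) * distinct_term k R * distinct_fps k (even R) n"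
      by (intro dvd_mult2 le_imp_power_dvd)
    from dvd_add[OF Suc this] show ?case unfolding distinct_fps_step by (simp add: algebra_simps)
  qed simp
  from this[of n] have 1: "fps_X ^ N dvd ?T n - (\<Sum>r\<le>R. distinct_term k r)" by simp
  have "?T n - distinct_fps k False n
    = (\<Sum>r<R. fps_X ^ (distinct_weight k (Suc r) * n) * distinct_term k (Suc r) * distinct_fps k (odd (Suc r)) n)"
    by (simp add: sum.atMost_shift distinct_weight_def[of k 0] del: distinct_term.simps(2))
  also have "fps_X ^ N dvd \<dots>"
  proof (intro dvd_sum dvd_mult2 le_imp_power_dvd)
    fix r
    have "N \<le> Suc r * n" using assms by (simp add: trans_le_add1)
    also have "\<dots> \<le> distinct_weight k (Suc r) * n" by (rule mult_le_mono1[OF distinct_weight_ge])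
    finally show "N \<le> distinct_weight k (Suc r) * n" .
  qed
  finally show ?thesis using dvd_diff[OF 1] by fastforce
qed

section \<open>The Durfee rectangle identity of Cauchy\<close>

text \<open>With \<open>Q = X^p\<close> and \<open>z = X^y\<close> this is \<open>Q^(s (s - 1)) z^s / ((z; Q)\<^sub>s (Q; Q)\<^sub>s)\<close>, the generating
  function of the multisets of \<open>z, z Q, z Q^2, \<dots>\<close> whose exponents of \<open>Q\<close> have a Durfee rectangle with
  \<open>s\<close> rows and \<open>s - 1\<close> columns.\<close>

fun cauchy_term :: "nat \<Rightarrow> nat \<Rightarrow> nat \<Rightarrow> rat fps" where
  "cauchy_term p y 0 = 1"
| "cauchy_term p y (Suc s) = cauchy_term p y s * fps_X ^ (y + 2 * p * s)
     * inverse (1 - fps_X ^ (y + p * s)) * inverse (1 - fps_X ^ (p * Suc s))"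

text \<open>Multiplication by \<open>1 - z\<close> turns the denominator \<open>(z; Q)\<^sub>s\<^sub>+\<^sub>1\<close> into \<open>(z Q; Q)\<^sub>s\<close>, which is the one
  of the preceding term for \<open>z Q\<close>.\<close>

lemma cauchy_term_shift:
  assumes "p > 0" "y > 0"
  shows "(1 - fps_X ^ y) * cauchy_term p y (Suc s)
    = cauchy_term p (y + p) s * fps_X ^ (y + p * s) * inverse (1 - fps_X ^ (p * Suc s))"
proof (induction s)
  case 0
  have "(1 - fps_X ^ y) * inverse (1 - fps_X ^ y) = (1 :: rat fps)"
    using inverse_one_minus_X_power[OF assms(2)] by (simp add: algebra_simps)
  then show ?case by (simp add: mult.assoc[symmetric])
next
  case (Suc s)
  have "(1 - fps_X ^ y) * cauchy_term p y (Suc (Suc s))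
    = ((1 - fps_X ^ y) * cauchy_term p y (Suc s)) * fps_X ^ (y + 2 * p * Suc s)
     * inverse (1 - fps_X ^ (y + p * Suc s)) * inverse (1 - fps_X ^ (p * Suc (Suc s)))"
    by (simp only: cauchy_term.simps(2)[of p y "Suc s"] mult.assoc)
  also have "\<dots> = cauchy_term p (y + p) (Suc s) * fps_X ^ (y + p * Suc s) * inverse (1 - fps_X ^ (p * Suc (Suc s)))"
    unfolding Suc by (simp add: power_add algebra_simps mult_2_right)
  finally show ?case .
qed

text \<open>The functional equation \<open>(1 - z) F(z) = F(z Q)\<close>, which holds for partial sums up to a single
  term because the termwise differences telescope.\<close>

lemma cauchy_sum_shift:
  assumes "p > 0" "y > 0"
  shows "(1 - fps_X ^ y) * (\<Sum>s\<le>S. cauchy_term p y s)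
    = (\<Sum>s\<le>S. cauchy_term p (y + p) s) - cauchy_term p (y + p) S * fps_X ^ (y + p * S)"
proof (induction S)
  case (Suc S)
  define c where "c = cauchy_term p (y + p) S"
  define u where "u = (fps_X ^ (y + p * S) :: rat fps)"
  define v where "v = (fps_X ^ (p * Suc S) :: rat fps)"
  define w where "w = (fps_X ^ (y + p * Suc S) :: rat fps)"
  define i where "i = inverse (1 - v)"
  define j where "j = inverse (1 - w)"
  have i: "i = 1 + v * i" unfolding i_def v_def by (rule inverse_one_minus_X_power) (use assms in simp)
  have j: "j = 1 + w * j" unfolding j_def w_def by (rule inverse_one_minus_X_power) (use assms in simp)
  have w: "w = fps_X ^ (y + p + p * S)" by (simp add: w_def algebra_simps)
  have uv: "fps_X ^ (y + p + 2 * p * S) = u * v"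
    by (simp add: u_def v_def power_add[symmetric] algebra_simps)
  have c': "cauchy_term p (y + p) (Suc S) = c * (u * v) * j * i"
    unfolding cauchy_term.simps(2) uv w[symmetric] by (simp add: c_def i_def j_def v_def)
  \<comment> \<open>The new term on the left has the same prefactor as the old boundary term.\<close>
  have new: "(1 - fps_X ^ y) * cauchy_term p y (Suc S) = c * u * i"
    unfolding cauchy_term_shift[OF assms] by (simp add: c_def u_def i_def v_def)
  have "(1 - fps_X ^ y) * (\<Sum>s\<le>Suc S. cauchy_term p y s)
    = (\<Sum>s\<le>S. cauchy_term p (y + p) s) - c * u + c * u * i"
    using Suc new by (simp add: c_def u_def distrib_left del: cauchy_term.simps)
  also have "\<dots> = (\<Sum>s\<le>S. cauchy_term p (y + p) s) + c * (u * v) * j * i - c * (u * v) * j * i * w"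
    using i j by algebra
  finally show ?case by (simp add: c' w_def del: cauchy_term.simps)
qed simp

lemma cauchy_term_dvd: "fps_X ^ y dvd cauchy_term p y (Suc s)"
  by (induction s) (simp_all add: power_add dvd_mult2 mult.assoc)

text \<open>Apply the functional equation \<open>J\<close> times; in \<open>F(z Q^J)\<close> only the term \<open>1\<close> has order below \<open>p J\<close>.\<close>

lemma cauchy_sum_approx:
  assumes "p > 0" "y > 0" "N \<le> p * J"
  shows "fps_X ^ N dvd (\<Sum>s\<le>N. cauchy_term p y s) - (\<Prod>j<J. inverse (1 - fps_X ^ (y + p * j)))"
proof -
  let ?i = "\<lambda>m. inverse (1 - fps_X ^ m :: rat fps)"
  let ?S = "\<lambda>y. \<Sum>s\<le>N. cauchy_term p y s"
  have "fps_X ^ N dvd ?S y - (\<Prod>j<J. ?i (y + p * j)) * ?S (y + p * J)" for J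
  proof (induction J)
    case (Suc J)
    let ?y = "y + p * J"
    have Suc_shift: "y + p * Suc J = ?y + p" by simp
    define e where "e = cauchy_term p (?y + p) N * fps_X ^ (?y + p * N)"
    have "N \<le> ?y + p * N" using assms(1) by (cases p) auto
    then have e: "fps_X ^ N dvd e" unfolding e_def by (intro dvd_mult le_imp_power_dvd)
    have "?i ?y = 1 + fps_X ^ ?y * ?i ?y" by (rule inverse_one_minus_X_power) (use assms in simp)
    moreover have "(1 - fps_X ^ ?y) * ?S ?y = ?S (?y + p) - e"
      unfolding e_def by (rule cauchy_sum_shift) (use assms in simp_all)
    moreover have "s = i * s' - i * e" if "i = 1 + x * i" "(1 - x) * s = s' - e" for i x s s' :: "rat fps"
      using that by algebra
    ultimately have "?S ?y = ?i ?y * ?S (?y + p) - ?i ?y * e" by blast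
    moreover have "t - (P * i) * s' = (t - P * s) - P * i * e" if "s = i * s' - i * e" for t P i s s' :: "rat fps"
      unfolding that by (simp add: algebra_simps)
    ultimately have "?S y - (\<Prod>j<Suc J. ?i (y + p * j)) * ?S (y + p * Suc J)
      = (?S y - (\<Prod>j<J. ?i (y + p * j)) * ?S ?y) - (\<Prod>j<J. ?i (y + p * j)) * ?i ?y * e"
      unfolding prod.lessThan_Suc Suc_shift by blast
    also have "fps_X ^ N dvd \<dots>" by (intro dvd_diff Suc dvd_mult e)
    finally show ?case .
  qed simp
  from this[of J] have 1: "fps_X ^ N dvd ?S y - (\<Prod>j<J. ?i (y + p * j)) * ?S (y + p * J)" .
  have "?S (y + p * J) - 1 = (\<Sum>s<N. cauchy_term p (y + p * J) (Suc s))"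
    by (simp add: sum.atMost_shift)
  also have "fps_X ^ N dvd \<dots>"
    by (intro dvd_sum dvd_trans[OF le_imp_power_dvd cauchy_term_dvd]) (use assms in simp)
  finally have "fps_X ^ N dvd (\<Prod>j<J. ?i (y + p * j)) * (?S (y + p * J) - 1)" by (rule dvd_mult)
  from dvd_add[OF 1 this] show ?thesis by (simp add: algebra_simps)
qed

section \<open>Comparison of the two generating functions\<close>

lemma X_power_double: "fps_X ^ (y + 2 * p * s) = fps_X ^ (p * s) * (fps_X ^ (y + p * s) :: rat fps)"
  unfolding power_add[symmetric] by (rule arg_cong[of _ _ "(^) fps_X"]) simp

lemma distinct_term_even: "distinct_term k (2 * s) = cauchy_term (4 * k + 8) (2 * k + 5) s * fps_X ^ ((4 * k + 8) * s)"
proof (induction s)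
  case (Suc s)
  have w: "distinct_weight k (Suc (2 * s)) = 2 * k + 5 + (4 * k + 8) * s"
    "distinct_weight k (Suc (Suc (2 * s))) = (4 * k + 8) * Suc s"
    by (simp_all add: distinct_weight_def add_mult_distrib2 add_mult_distrib mod_Suc)
  have e: "distinct_term k (2 * Suc s) = distinct_term k (Suc (Suc (2 * s)))" by (simp del: distinct_term.simps)
  show ?case unfolding e distinct_term.simps cauchy_term.simps Suc w
    unfolding X_power_double by (simp only: mult_ac)
qed simp

text \<open>The weight of \<open>2 s + 2\<close> has no odd correction, so \<open>z\<close> enters only through the odd columns; the
  sum of two neighbouring terms removes the numerator of the even column of length \<open>2 s + 2\<close>.\<close>

lemma distinct_term_pair:
  "distinct_term k (Suc (2 * s)) + distinct_term k (Suc (Suc (2 * s))) = cauchy_term (4 * k + 8) (2 * k + 5) (Suc s)"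
proof -
  let ?p = "4 * k + 8" and ?y = "2 * k + 5"
  have w: "distinct_weight k (Suc (2 * s)) = ?y + ?p * s"
    "distinct_weight k (Suc (Suc (2 * s))) = ?p * Suc s"
    by (simp_all add: distinct_weight_def add_mult_distrib2 add_mult_distrib mod_Suc)
  have i: "inverse (1 - fps_X ^ (?p * Suc s)) = 1 + fps_X ^ (?p * Suc s) * inverse (1 - fps_X ^ (?p * Suc s) :: rat fps)"
    by (rule inverse_one_minus_X_power) simp
  have c: "c + c * x * i = c * i" if "i = 1 + x * i" for c x i :: "rat fps"
    using that by algebra
  have "distinct_term k (Suc (2 * s)) + distinct_term k (Suc (Suc (2 * s)))
      = distinct_term k (Suc (2 * s)) * inverse (1 - fps_X ^ (?p * Suc s))"
    unfolding distinct_term.simps(2)[of k "Suc (2 * s)"] w using c[OF i] by simp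
  also have "\<dots> = cauchy_term ?p ?y (Suc s)"
    unfolding distinct_term.simps cauchy_term.simps w distinct_term_even
    unfolding X_power_double by (simp only: mult_ac)
  finally show ?thesis .
qed

lemma sum_distinct_term: "(\<Sum>r\<le>2 * S. distinct_term k r) = (\<Sum>s\<le>S. cauchy_term (4 * k + 8) (2 * k + 5) s)"
proof (induction S)
  case (Suc S)
  have "2 * Suc S = Suc (Suc (2 * S))" by simp
  then show ?case
    by (simp only: sum.atMost_Suc Suc distinct_term_pair[symmetric] add.assoc)
qed simp

lemma nth_eq_of_dvd_diff:
  fixes f g :: "rat fps"
  assumes "fps_X ^ N dvd f - g" "i < N"
  shows "fps_nth f i = fps_nth g i"
proof -
  from assms(1) obtain h where "f - g = fps_X ^ N * h" by blast
  then have "fps_nth (f - g) i = 0" using assms(2) by (simp add: fps_X_power_mult_nth)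
  then show ?thesis by simp
qed

definition P_parts :: "nat \<Rightarrow> nat \<Rightarrow> nat set" where
  "P_parts k n = {m \<in> {1..n}. even m \<or> [m = 2 * k + 5] (mod (4 * k + 8))}"

lemma part_bounds: "\<lbrakk>xs \<in> partitions_of N; x \<in> set xs\<rbrakk> \<Longrightarrow> 1 \<le> x \<and> x \<le> N"
  using member_le_sum_list[of x xs]
  by (auto simp: partitions_of_def is_partition_def Suc_le_eq intro: gr0I)

lemma card_cond_P:
  assumes "N \<le> n"
  shows "of_nat (card {xs \<in> partitions_of N. cond_P k xs}) = fps_nth (gen_fun (parts_in (P_parts k n))) N"
proof -
  have "{xs \<in> partitions_of N. cond_P k xs} = {xs \<in> parts_in (P_parts k n). sum_list xs = N}"
    using assms by (auto simp: parts_in_def P_parts_def cond_P_def dest: part_bounds)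
      (auto simp: partitions_of_def)
  then show ?thesis by (simp add: gen_fun_def)
qed

lemma card_cond_C:
  assumes "N \<le> n"
  shows "of_nat (card {xs \<in> partitions_of N. cond_C k xs}) = fps_nth (gen_fun (C_partitions k False n)) N"
proof -
  have "{xs \<in> partitions_of N. cond_C k xs} = {xs \<in> C_partitions k False n. sum_list xs = N}"
  proof -
    have "set xs \<subseteq> {..n}" if "xs \<in> partitions_of N" for xs
      using part_bounds[OF that] assms by fastforce
    then show ?thesis by (auto simp: C_partitions_def cond_C_def partitions_of_def)
  qed
  then show ?thesis by (simp add: gen_fun_def)
qed

text \<open>Conjugation is an involution on the partitions of \<open>n\<close> which exchanges the two conditions.\<close>

lemma card_cond_S_eq_cond_C:
  "card {xs \<in> partitions_of n. cond_S k xs} = card {xs \<in> partitions_of n. cond_C k xs}"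
proof (rule bij_betw_same_card)
  show "bij_betw conjugate {xs \<in> partitions_of n. cond_S k xs} {xs \<in> partitions_of n. cond_C k xs}"
    by (rule bij_betwI[where g = conjugate])
      (auto simp: partitions_of_def is_partition_conjugate sum_list_conjugate conjugate_conjugate
        cond_S_iff cond_C_conjugate_iff[symmetric])
qed

text \<open>Cutting at a multiple of the period makes the two kinds of parts match the even multiplicities
  and the finite product in \<open>cauchy_sum_approx\<close> exactly.\<close>

lemma P_parts_period:
  "P_parts k ((4 * k + 8) * J) = (*) 2 ` {1..(2 * k + 4) * J} \<union> (\<lambda>j. 2 * k + 5 + (4 * k + 8) * j) ` {..<J}"
  (is "_ = ?E \<union> ?O")
proof (intro subset_antisym subsetI)
  fix m assume m: "m \<in> P_parts k ((4 * k + 8) * J)"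
  show "m \<in> ?E \<union> ?O"
  proof (cases "even m")
    case True
    then obtain i where i: "m = 2 * i" by blast
    have "2 * i \<le> 2 * ((2 * k + 4) * J)" using m i by (simp add: P_parts_def algebra_simps)
    then have "i \<in> {1..(2 * k + 4) * J}" using m i by (simp add: P_parts_def)
    then show ?thesis using i by blast
  next
    case False
    with m have "m mod (4 * k + 8) = 2 * k + 5" by (simp add: P_parts_def cong_def)
    then have e: "m = 2 * k + 5 + (4 * k + 8) * (m div (4 * k + 8))"
      using mod_mult_div_eq[of m "4 * k + 8"] by simp
    have "m \<le> (4 * k + 8) * J" using m by (simp add: P_parts_def)
    then have "(4 * k + 8) * (m div (4 * k + 8)) < (4 * k + 8) * J" using e by linarith
    then have "m div (4 * k + 8) \<in> {..<J}" by simp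
    then show ?thesis using e by blast
  qed
next
  fix m assume "m \<in> ?E \<union> ?O"
  then show "m \<in> P_parts k ((4 * k + 8) * J)"
  proof (elim UnE imageE)
    fix i assume "m = 2 * i" "i \<in> {1..(2 * k + 4) * J}"
    then show ?thesis by (auto simp: P_parts_def algebra_simps)
  next
    fix j assume m: "m = 2 * k + 5 + (4 * k + 8) * j" "j \<in> {..<J}"
    then have "(4 * k + 8) * Suc j \<le> (4 * k + 8) * J" by (intro mult_le_mono2) simp
    then have "m \<le> (4 * k + 8) * J" unfolding m(1) by simp
    moreover have "[m = 2 * k + 5] (mod (4 * k + 8))"
      unfolding m(1) cong_def by (rule mod_mult_self2)
    ultimately show ?thesis using m(1) by (simp add: P_parts_def)
  qed
qed

lemma gen_fun_P_period:
  "gen_fun (parts_in (P_parts k ((4 * k + 8) * J)))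
   = (\<Prod>i\<in>{1..(2 * k + 4) * J}. inverse (1 - fps_X ^ (2 * i)))
     * (\<Prod>j<J. inverse (1 - fps_X ^ (2 * k + 5 + (4 * k + 8) * j)))"
proof -
  let ?E = "(*) 2 ` {1..(2 * k + 4) * J}" and ?O = "(\<lambda>j. 2 * k + 5 + (4 * k + 8) * j) ` {..<J}"
  have disj: "?E \<inter> ?O = {}"
  proof -
    have "even m" if "m \<in> ?E" for m using that by auto
    moreover have "odd m" if "m \<in> ?O" for m using that by auto
    ultimately show ?thesis by blast
  qed
  have "gen_fun (parts_in (P_parts k ((4 * k + 8) * J))) = (\<Prod>m\<in>?E \<union> ?O. inverse (1 - fps_X ^ m))"
    unfolding P_parts_period[symmetric] by (rule gen_fun_parts_in) (auto simp: P_parts_def)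
  also have "\<dots> = (\<Prod>m\<in>?E. inverse (1 - fps_X ^ m)) * (\<Prod>m\<in>?O. inverse (1 - fps_X ^ m))"
    by (rule prod.union_disjoint) (use disj in auto)
  also have "(\<Prod>m\<in>?E. inverse (1 - fps_X ^ m)) = (\<Prod>i\<in>{1..(2 * k + 4) * J}. inverse (1 - fps_X ^ (2 * i)))"
    by (subst prod.reindex) (auto simp: inj_on_def)
  also have "(\<Prod>m\<in>?O. inverse (1 - fps_X ^ m)) = (\<Prod>j<J. inverse (1 - fps_X ^ (2 * k + 5 + (4 * k + 8) * j)))"
    by (subst prod.reindex) (auto simp: inj_on_def)
  finally show ?thesis .
qed

lemma card_cond_P_eq_cond_C:
  "card {xs \<in> partitions_of n. cond_P k xs} = card {xs \<in> partitions_of n. cond_C k xs}"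
proof -
  let ?N = "Suc n" and ?m = "(2 * k + 4) * Suc n"
  let ?even = "\<Prod>i\<in>{1..?m}. inverse (1 - fps_X ^ (2 * i)) :: rat fps"
  let ?odd = "\<Prod>j<?N. inverse (1 - fps_X ^ (2 * k + 5 + (4 * k + 8) * j)) :: rat fps"
  have le: "?N \<le> ?m" "?N \<le> (4 * k + 8) * ?N"
    using mult_le_mono1[of 1 "2 * k + 4" ?N] mult_le_mono1[of 1 "4 * k + 8" ?N] by simp_all
  have 1: "fps_X ^ ?N dvd distinct_fps k False ?m - (\<Sum>r\<le>2 * ?N. distinct_term k r)"
    by (rule distinct_fps_approx[OF le(1)]) simp
  have 2: "fps_X ^ ?N dvd (\<Sum>r\<le>2 * ?N. distinct_term k r) - ?odd"
    unfolding sum_distinct_term by (rule cauchy_sum_approx[OF _ _ le(2)]) simp_all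
  from dvd_add[OF 1 2] have "fps_X ^ ?N dvd distinct_fps k False ?m - ?odd"
    by (simp only: add_diff_eq diff_add_cancel)
  then have "fps_X ^ ?N dvd (distinct_fps k False ?m - ?odd) * ?even" by (rule dvd_mult2)
  then have "fps_X ^ ?N dvd gen_fun (C_partitions k False ?m) - gen_fun (parts_in (P_parts k ((4 * k + 8) * ?N)))"
    unfolding gen_fun_C_partitions gen_fun_P_period by (simp only: left_diff_distrib mult.commute[of ?even])
  from nth_eq_of_dvd_diff[OF this, of n]
  have "fps_nth (gen_fun (C_partitions k False ?m)) n
      = fps_nth (gen_fun (parts_in (P_parts k ((4 * k + 8) * ?N)))) n" by simp
  moreover have n: "n \<le> ?m" "n \<le> (4 * k + 8) * ?N" using le by linarith+
  ultimately have "(of_nat (card {xs \<in> partitions_of n. cond_P k xs}) :: rat)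
      = of_nat (card {xs \<in> partitions_of n. cond_C k xs})"
    by (simp only: card_cond_P[OF n(2)] card_cond_C[OF n(1)])
  then show ?thesis by (simp only: of_nat_eq_iff)
qed

text \<open>The partial products are the generating functions with bounded parts, and a bound of at least \<open>N\<close>
  does not affect the coefficient of \<open>X^N\<close>.  The limit is nonzero, as convergence of a
  product demands, because of the empty partition.\<close>

lemma has_prod_cond_P:
  "(\<lambda>m. if m \<ge> 1 \<and> (even m \<or> [m = 2 * k + 5] (mod (4 * k + 8)))
            then inverse (1 - fps_X ^ m) else 1)
        has_prod (Abs_fps (\<lambda>n. of_nat (card {xs \<in> partitions_of n. cond_P k xs})) :: rat fps)"
  (is "?f has_prod ?p")
proof -
  have partial: "(\<Prod>i\<le>n. ?f i) = gen_fun (parts_in (P_parts k n))" for n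
  proof -
    have "P_parts k n = {m \<in> {..n}. m \<ge> 1 \<and> (even m \<or> [m = 2 * k + 5] (mod (4 * k + 8)))}"
      by (auto simp: P_parts_def)
    then have "(\<Prod>m\<in>P_parts k n. inverse (1 - fps_X ^ m)) = (\<Prod>i\<le>n. ?f i)"
      by (simp only: prod.inter_filter[OF finite_atMost])
    moreover have "gen_fun (parts_in (P_parts k n)) = (\<Prod>m\<in>P_parts k n. inverse (1 - fps_X ^ m))"
      by (rule gen_fun_parts_in) (auto simp: P_parts_def)
    ultimately show ?thesis by simp
  qed
  have "(\<lambda>n. \<Prod>i\<le>n. ?f i) \<longlonglongrightarrow> ?p"
  proof (rule tendsto_fpsI)
    fix N
    have "fps_nth (\<Prod>i\<le>n. ?f i) N = fps_nth ?p N" if "N \<le> n" for n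
      using card_cond_P[OF that, of k] unfolding partial by simp
    then show "\<forall>\<^sub>F n in sequentially. fps_nth (\<Prod>i\<le>n. ?f i) N = fps_nth ?p N"
      by (rule eventually_sequentiallyI)
  qed
  moreover have "fps_nth ?p 0 = 1"
  proof -
    have "{xs \<in> partitions_of 0. cond_P k xs} = {[]}"
    proof -
      have "xs = []" if "xs \<in> partitions_of 0" for xs
        using part_bounds[OF that] by (cases xs) fastforce+
      moreover have "[] \<in> partitions_of 0" "cond_P k []"
        by (simp_all add: partitions_of_def is_partition_def cond_P_def)
      ultimately show ?thesis by blast
    qed
    then show ?thesis by simp
  qed
  then have "?p \<noteq> 0" by (metis fps_zero_nth zero_neq_one)
  ultimately show ?thesis unfolding has_prod_def raw_has_prod_def add_0_right by blast
qed

theorem mainTheorem8: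
  fixes k :: nat
  assumes "k \<ge> 1"
  shows "(\<forall>n. card {xs \<in> partitions_of n. cond_P k xs} = card {xs \<in> partitions_of n. cond_S k xs})
    \<and> (\<lambda>m. if m \<ge> 1 \<and> (even m \<or> [m = 2 * k + 5] (mod (4 * k + 8)))
            then inverse (1 - fps_X ^ m) else 1)
        has_prod (Abs_fps (\<lambda>n. of_nat (card {xs \<in> partitions_of n. cond_P k xs})) :: rat fps)
    \<and> (\<forall>xs. is_partition xs \<longrightarrow> (cond_S k xs \<longleftrightarrow> cond_C k (conjugate xs)))"
proof (intro conjI allI impI)
  show "card {xs \<in> partitions_of n. cond_P k xs} = card {xs \<in> partitions_of n. cond_S k xs}" for n
    unfolding card_cond_S_eq_cond_C by (rule card_cond_P_eq_cond_C)
  show "cond_S k xs \<longleftrightarrow> cond_C k (conjugate xs)" if "is_partition xs" for xs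
    unfolding cond_S_iff[OF that] cond_C_conjugate_iff[OF that] ..
qed (rule has_prod_cond_P)

end
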